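(* Let $n$ range over an interval of real numbers, and for each $n$ let $F_n$ and $G_n$ be cumulative distribution functions on $[0,1]$ with densities $f_n$ and $g_n$ that are continuous in $n$. Assume that for each $n$: (1) $f_n,g_n$ are positive on $(0,1)$ and $t_n(x):=f_n(x)/g_n(x)$ is positive and strictly convex on $(0,1)$ with $\lim_{x\to0}t_n(x)=\lim_{x\to1}t_n(x)=\infty$; (2) $f_n,g_n$ are continuous on $[0,1]$ and twice differentiable on $(0,1)$, the second derivative of $t_n$ is strictly positive on $(0,1)$, and the push-forward map $y_n:(0,1)\to(0,1)$ from $f_n$ to $g_n$ is such that $\lim_{x\searrow0}y_n'(x)$ and $\lim_{x\nearrow1}y_n'(x)$ exist in $(1,\infty]$. Let $x^*=x^*(n)$ be the unique solution in $(0,1)$ of $$F_n(x)-G_n(x)=\int_0^x\bigl(f_n(t)-g_n(t)\bigr)\,dt=0.$$ Then $x^*$ depends continuously on $n$.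
   Context: The push-forward map from a density $f$ to a density $g$ (both continuous on $[0,1]$ and positive on $(0,1)$) is the unique diffeomorphism $y:(0,1)\to(0,1)$ with $g(y(x))\,y'(x)=f(x)$ for all $x\in(0,1)$; equivalently, $\int_0^{y(x)}g=\int_0^x f$. "Continuous in $n$" means that for each $x\in(0,1)$ the maps $n\mapsto f_n(x)$ and $n\mapsto g_n(x)$ are continuous. Under the assumptions in (2), the equation $F_n(x)=G_n(x)$ has exactly one solution in $(0,1)$. *)

theory Defs
  imports "HOL-Probability.Probability"
begin

(* F need only agree with the library's cdf on the unit interval, and the values of the density
   outside it are irrelevant.  The measurability clause is needed because density is only
   meaningful for measurable functions. *)
definition cdf_with_density_on_unit :: "(real \<Rightarrow> real) \<Rightarrow> (real \<Rightarrow> real) \<Rightarrow> bool" where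
  "cdf_with_density_on_unit F f \<longleftrightarrow>
     set_borel_measurable borel {0..1} f \<and>
     (\<forall>x\<in>{0..1}. 0 \<le> f x) \<and>
     (let M = density lborel (\<lambda>x. ennreal (indicator {0..1} x * f x))
      in prob_space M \<and> (\<forall>x\<in>{0..1}. F x = cdf M x))"

definition strictly_convex_on :: "real set \<Rightarrow> (real \<Rightarrow> real) \<Rightarrow> bool" where
  "strictly_convex_on S h \<longleftrightarrow> convex S \<and>
     (\<forall>x\<in>S. \<forall>y\<in>S. x \<noteq> y \<longrightarrow>
        (\<forall>u>0. \<forall>v>0. u + v = 1 \<longrightarrow> h (u * x + v * y) < u * h x + v * h y))"

definition twice_differentiable_on_open_unit :: "(real \<Rightarrow> real) \<Rightarrow> bool" where
  "twice_differentiable_on_open_unit h \<longleftrightarrow>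
     (\<forall>x\<in>{0<..<1}. h differentiable (at x) \<and> deriv h differentiable (at x))"

definition diffeo_open_unit :: "(real \<Rightarrow> real) \<Rightarrow> bool" where
  "diffeo_open_unit y \<longleftrightarrow>
     bij_betw y {0<..<1} {0<..<1} \<and>
     y C1_differentiable_on {0<..<1} \<and>
     inv_into {0<..<1} y C1_differentiable_on {0<..<1}"

(* The push-forward map of a given pair of densities is unique as a map on the open unit interval;
   as a total function, y is unconstrained elsewhere. *)
definition is_push_forward_map :: "(real \<Rightarrow> real) \<Rightarrow> (real \<Rightarrow> real) \<Rightarrow> (real \<Rightarrow> real) \<Rightarrow> bool" where
  "is_push_forward_map f g y \<longleftrightarrow>
     diffeo_open_unit y \<and> (\<forall>x\<in>{0<..<1}. g (y x) * deriv y x = f x)"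

definition is_crossing :: "(real \<Rightarrow> real) \<Rightarrow> (real \<Rightarrow> real) \<Rightarrow> real \<Rightarrow> bool" where
  "is_crossing F G x \<longleftrightarrow> x \<in> {0<..<1} \<and> F x - G x = 0"

end

theory Submission
  imports Defs
begin

text \<open>
  Write \<open>H\<^sub>n = F\<^sub>n - G\<^sub>n\<close>.  Its derivative \<open>f\<^sub>n - g\<^sub>n = g\<^sub>n (t\<^sub>n - 1)\<close> is positive near both endpoints,
  because \<open>t\<^sub>n\<close> blows up there, and the set where it is negative is an interval, because \<open>t\<^sub>n\<close>
  is convex.  As \<open>H\<^sub>n\<close> vanishes at \<open>0\<close> and at \<open>1\<close>, it is positive just after \<open>0\<close> and negative just
  before \<open>1\<close>.  A second sign change would force the derivative to be negative, then nonnegative,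
  then negative again, so \<open>H\<^sub>n\<close> changes sign exactly once, strictly from plus to minus
  (\<open>sign_change_of_interval_decrease\<close>).

  A strict sign change is stable: if \<open>c\<close> is the zero of \<open>H\<^sub>n\<close> and
  \<open>0 < a < c < b < 1\<close>, then \<open>H\<^sub>n(a) > 0 > H\<^sub>n(b)\<close>, and both
  inequalities persist for nearby parameters as soon as \<open>H\<close> is continuous in \<open>n\<close> at each fixed point
  (\<open>continuous_on_sign_change\<close>).  That continuity follows from the pointwise continuity of
  the densities by Scheffe's lemma: densities of total mass one that converge pointwise converge in
  \<open>L\<^sup>1\<close> (\<open>cdf_tendsto_if_densities_tendsto\<close>).
\<close>

section \<open>Distribution functions with a density on the unit interval\<close>

lemma integrable_density_on_unit:
  assumes "cdf_with_density_on_unit F f"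
  shows "integrable lborel (\<lambda>s. indicator {0..1} s * f s)"
    and "(\<integral>\<^sup>+ s. ennreal (indicator {0..1} s * f s) \<partial>lborel) = 1"
    and "0 \<le> indicator {0..1} s * f s"
proof -
  let ?p = "\<lambda>s. indicator {0..1} s * f s"
  have meas [measurable]: "?p \<in> borel_measurable borel"
    using assms by (simp add: cdf_with_density_on_unit_def set_borel_measurable_def)
  show nonneg: "0 \<le> ?p s" for s
    using assms by (auto simp: cdf_with_density_on_unit_def indicator_def)
  have "prob_space (density lborel (\<lambda>s. ennreal (?p s)))"
    using assms by (simp add: cdf_with_density_on_unit_def Let_def)
  then have "emeasure (density lborel (\<lambda>s. ennreal (?p s))) UNIV = 1"
    using prob_space.emeasure_space_1 by fastforce
  then show total: "(\<integral>\<^sup>+ s. ennreal (?p s) \<partial>lborel) = 1"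
    by (simp add: emeasure_density)
  show "integrable lborel ?p"
    using meas nonneg total by (intro integrableI_nonneg) auto
qed

lemma cdf_on_unit_eq_lebesgue_integral:
  assumes "cdf_with_density_on_unit F f" "x \<in> {0..1}"
  shows "F x = (\<integral>s. indicator {..x} s * (indicator {0..1} s * f s) \<partial>lborel)"
proof -
  let ?p = "\<lambda>s. indicator {0..1} s * f s"
  note p = integrable_density_on_unit[OF assms(1)]
  have [measurable]: "?p \<in> borel_measurable borel"
    using p(1) by auto
  have "F x = measure (density lborel (\<lambda>s. ennreal (?p s))) {..x}"
    using assms by (simp add: cdf_with_density_on_unit_def Let_def cdf_def)
  also have "\<dots> = enn2real (\<integral>\<^sup>+ s. ennreal (?p s) * indicator {..x} s \<partial>lborel)"
    by (simp add: measure_def emeasure_density)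
  also have "\<dots> = enn2real (\<integral>\<^sup>+ s. ennreal (indicator {..x} s * ?p s) \<partial>lborel)"
    by (intro arg_cong[of _ _ enn2real] nn_integral_cong) (auto simp: indicator_def)
  also have "\<dots> = (\<integral>s. indicator {..x} s * ?p s \<partial>lborel)"
    using p(3) by (subst integral_eq_nn_integral) auto
  finally show ?thesis .
qed

lemma cdf_on_unit_eq_integral:
  assumes F: "cdf_with_density_on_unit F f" and f: "continuous_on {0..1} f" and x: "x \<in> {0..1}"
  shows "F x = integral {0..x} f"
proof -
  have "F x = (LINT s:{0..x}|lborel. f s)"
    unfolding cdf_on_unit_eq_lebesgue_integral[OF F x] set_lebesgue_integral_def
    using x by (intro Bochner_Integration.integral_cong) (auto simp: indicator_def)
  also have "\<dots> = integral {0..x} f"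
    using x by (intro set_borel_integral_eq_integral borel_integrable_atLeastAtMost'
      continuous_on_subset[OF f]) auto
  finally show ?thesis .
qed

lemma cdf_on_unit_at_1:
  assumes "cdf_with_density_on_unit F f"
  shows "F 1 = 1"
proof -
  have "F 1 = (\<integral>s. indicator {..1} s * (indicator {0..1} s * f s) \<partial>lborel)"
    using cdf_on_unit_eq_lebesgue_integral[OF assms, of 1] by simp
  also have "\<dots> = (\<integral>s. indicator {0..1} s * f s \<partial>lborel)"
    by (intro Bochner_Integration.integral_cong) (auto simp: indicator_def)
  also have "\<dots> = 1"
    using integrable_density_on_unit[OF assms] by (subst integral_eq_nn_integral) auto
  finally show ?thesis .
qed

lemma cdf_on_unit_has_derivative:
  assumes "cdf_with_density_on_unit F f" "continuous_on {0..1} f" "x \<in> {0..1}"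
  shows "(F has_real_derivative f x) (at x within {0..1})"
  using integral_has_real_derivative[OF assms(2,3)]
  by (rule has_field_derivative_transform_within[of _ _ _ _ 1])
     (use assms in \<open>auto simp: cdf_on_unit_eq_integral\<close>)

section \<open>Continuity of the distribution function in the density\<close>

text \<open>
  Pointwise convergence alone would not let the limit pass under the integral; the common total
  mass one is what prevents mass from escaping, and it lets Scheffe's lemma apply.  Convergence in \<open>L\<^sup>1\<close> on the whole interval then bounds the error on every
  initial segment.
\<close>

lemma cdf_tendsto_if_densities_tendsto:
  fixes F f :: "nat \<Rightarrow> real \<Rightarrow> real"
  assumes F: "\<And>k. cdf_with_density_on_unit (F k) (f k)"
    and F': "cdf_with_density_on_unit F' f'"
    and lim: "\<And>s. s \<in> {0<..<1} \<Longrightarrow> (\<lambda>k. f k s) \<longlonglongrightarrow> f' s"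
    and x: "x \<in> {0..1}"
  shows "(\<lambda>k. F k x) \<longlonglongrightarrow> F' x"
proof -
  let ?p = "\<lambda>k s. indicator {0..1} s * f k s" and ?p' = "\<lambda>s. indicator {0..1} s * f' s"
  let ?c = "\<lambda>s. indicator {..x} s :: real"
  note p = integrable_density_on_unit[OF F] and p' = integrable_density_on_unit[OF F']
  \<comment> \<open>The densities may fail to converge at the two endpoints, which form a null set.\<close>
  have "AE s in lborel. s \<noteq> (0::real) \<and> s \<noteq> 1"
    using AE_lborel_singleton[of "0::real"] AE_lborel_singleton[of "1::real"] by auto
  then have AE: "AE s in lborel. (\<lambda>k. ?p k s) \<longlonglongrightarrow> ?p' s"
    by eventually_elim (auto simp: indicator_def intro: lim)
  have L1: "(\<lambda>k. \<integral>\<^sup>+ s. norm (?p k s - ?p' s) \<partial>lborel) \<longlonglongrightarrow> 0"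
  proof (rule Scheffe_lemma2[OF _ p'(1) AE])
    show "?p k \<in> borel_measurable lborel" for k
      using p(1) by (rule borel_measurable_integrable)
    show "(\<integral>\<^sup>+ s. norm (?p k s) \<partial>lborel) \<le> (\<integral>\<^sup>+ s. norm (?p' s) \<partial>lborel)" for k
      unfolding real_norm_def abs_of_nonneg[OF p(3)] abs_of_nonneg[OF p'(3)]
      by (simp add: p(2) p'(2))
  qed
  have cut_int: "integrable lborel (\<lambda>s. ?c s * ?p k s)" "integrable lborel (\<lambda>s. ?c s * ?p' s)" for k
    using integrable_mult_indicator[of "{..x}", OF _ p(1)[of k]]
      integrable_mult_indicator[of "{..x}", OF _ p'(1)] by simp_all
  have "(\<lambda>k. \<integral>\<^sup>+ s. norm (?c s * ?p k s - ?c s * ?p' s) \<partial>lborel) \<longlonglongrightarrow> 0"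
    by (rule tendsto_sandwich[OF _ _ tendsto_const L1])
       (auto intro!: always_eventually nn_integral_mono simp: indicator_def)
  from tendsto_L1_int[OF cut_int this]
  show ?thesis
    by (simp add: cdf_on_unit_eq_lebesgue_integral[OF F x] cdf_on_unit_eq_lebesgue_integral[OF F' x])
qed

corollary continuous_on_cdf_param:
  assumes F: "\<And>n. n \<in> I \<Longrightarrow> cdf_with_density_on_unit (F n) (f n)"
    and f: "\<And>s. s \<in> {0<..<1} \<Longrightarrow> continuous_on I (\<lambda>n::real. f n s)"
    and x: "x \<in> {0..1}"
  shows "continuous_on I (\<lambda>n. F n x)"
proof (rule continuous_on_sequentiallyI)
  fix u :: "nat \<Rightarrow> real" and a
  assume u: "\<forall>k. u k \<in> I" "a \<in> I" "u \<longlonglongrightarrow> a"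
  show "(\<lambda>k. F (u k) x) \<longlonglongrightarrow> F a x"
  proof (rule cdf_tendsto_if_densities_tendsto[OF _ _ _ x])
    show "(\<lambda>k. f (u k) s) \<longlonglongrightarrow> f a s" if "s \<in> {0<..<1}" for s
      using continuous_on_tendsto_compose[OF f[OF that] u(3,2)] u(1) by simp
  qed (use F u in auto)
qed

section \<open>The unique sign change and its stability\<close>

text \<open>
  Starting from \<open>0\<close> and returning to \<open>0\<close> with positive slope at both ends, \<open>H\<close> takes
  positive values arbitrarily close to \<open>0\<close> and negative values arbitrarily close to \<open>1\<close>.  If
  \<open>H x \<le> 0 \<le> H z\<close> for some \<open>x < z\<close>, the mean value theorem on the three successive intervals
  from a positive value to \<open>x\<close>, from \<open>x\<close> to \<open>z\<close>, and from \<open>z\<close> to a negative value gives slopes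
  that are negative, nonnegative and negative in this order, which an interval of negative slopes
  excludes.
\<close>

lemma sign_change_of_interval_decrease:
  fixes H h :: "real \<Rightarrow> real"
  assumes der: "\<And>x. x \<in> {0..1} \<Longrightarrow> (H has_real_derivative h x) (at x within {0..1})"
    and ends: "H 0 = 0" "H 1 = 0"
    and pos0: "eventually (\<lambda>x. 0 < h x) (at_right 0)"
    and pos1: "eventually (\<lambda>x. 0 < h x) (at_left 1)"
    and neg: "is_interval {x \<in> {0<..<1}. h x < 0}"
  obtains c where "c \<in> {0<..<1}" "H c = 0"
    "\<And>x. x \<in> {0<..<c} \<Longrightarrow> 0 < H x" "\<And>x. x \<in> {c<..<1} \<Longrightarrow> H x < 0"
proof -
  have cont: "continuous_on {0..1} H"
    using der by (rule DERIV_continuous_on)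
  have mean: "\<exists>m\<in>{a<..<b}. H b - H a = (b - a) * h m" if ab: "0 \<le> a" "a < b" "b \<le> 1" for a b
  proof -
    have "(H has_derivative (*) (h m)) (at m)" if "a < m" "m < b" for m
      using der[of m] that ab at_within_Icc_at[of 0 m 1] by (simp add: has_field_derivative_def)
    moreover have "continuous_on {a..b} H"
      using ab by (intro continuous_on_subset[OF cont]) auto
    ultimately obtain m where "a < m" "m < b" "H b - H a = h m * (b - a)"
      using mvt[OF ab(2), of H "\<lambda>m. (*) (h m)"] by blast
    then show ?thesis by (auto simp: mult.commute)
  qed
  have early: "\<exists>e\<in>{0<..<x}. 0 < H e" if x: "0 < x" "x \<le> 1" for x
  proof -
    obtain d where d: "d > 0" "\<And>m. 0 < m \<Longrightarrow> m < d \<Longrightarrow> 0 < h m"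
      using pos0 by (auto simp: eventually_at_right_field)
    define e where "e = min d x / 2"
    have e: "0 < e" "e < d" "e < x" using d x by (auto simp: e_def min_def)
    then obtain m where "m \<in> {0<..<e}" "H e - H 0 = (e - 0) * h m"
      using mean[of 0 e] x by auto
    then have "0 < H e" using d(2)[of m] e ends by simp
    then show ?thesis using e by auto
  qed
  have late: "\<exists>e\<in>{z<..<1}. H e < 0" if z: "0 \<le> z" "z < 1" for z
  proof -
    obtain d where d: "d < 1" "\<And>m. d < m \<Longrightarrow> m < 1 \<Longrightarrow> 0 < h m"
      using pos1 by (auto simp: eventually_at_left_field)
    define e where "e = (max d z + 1) / 2"
    have e: "e < 1" "d < e" "z < e" using d z by (auto simp: e_def max_def)
    then obtain m where "m \<in> {e<..<1}" "H 1 - H e = (1 - e) * h m"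
      using mean[of e 1] z by auto
    moreover from this have "0 < (1 - e) * h m" using d(2)[of m] e by auto
    ultimately have "H e < 0" using ends by auto
    then show ?thesis using e by auto
  qed
  have no_return: "0 < H x \<or> H z < 0" if xz: "0 < x" "x < z" "z < 1" for x z
  proof (rule ccontr)
    assume "\<not> ?thesis"
    then have contra: "H x \<le> 0" "0 \<le> H z" by auto
    obtain e e' where e: "e \<in> {0<..<x}" "0 < H e" and e': "e' \<in> {z<..<1}" "H e' < 0"
      using early[of x] late[of z] xz by auto
    obtain p where p: "p \<in> {e<..<x}" "H x - H e = (x - e) * h p"
      using mean[of e x] e xz by auto
    obtain q where q: "q \<in> {x<..<z}" "H z - H x = (z - x) * h q"
      using mean[of x z] xz by auto
    obtain r where r: "r \<in> {z<..<e'}" "H e' - H z = (e' - z) * h r"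
      using mean[of z e'] e' xz by auto
    have "(x - e) * h p < 0" "(e' - z) * h r < 0" "0 \<le> (z - x) * h q"
      using p(2) q(2) r(2) contra e(2) e'(2) by linarith+
    then have "h p < 0" "h r < 0" "0 \<le> h q"
      using e(1) e'(1) xz by (auto simp: mult_less_0_iff zero_le_mult_iff)
    moreover have "q \<in> {x \<in> {0<..<1}. h x < 0}"
      using neg[unfolded is_interval_1, rule_format, of p r q] calculation p q r e e' xz by auto
    ultimately show False by auto
  qed
  obtain e where e: "e \<in> {0<..<1}" "0 < H e" using early[of 1] by auto
  obtain e' where e': "e' \<in> {e<..<1}" "H e' < 0" using late[of e] e by auto
  have "\<exists>c. e \<le> c \<and> c \<le> e' \<and> H c = 0"
    using e e' by (intro IVT2' continuous_on_subset[OF cont]) auto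
  then obtain c where "e \<le> c" "c \<le> e'" "H c = 0"
    by blast
  with e e' have c: "c \<in> {0<..<1}" "H c = 0"
    by auto
  show thesis
  proof (rule that[OF c])
    show "0 < H x" if "x \<in> {0<..<c}" for x using no_return[of x c] that c by auto
    show "H x < 0" if "x \<in> {c<..<1}" for x using no_return[of c x] that c by auto
  qed
qed

text \<open>
  The sign of \<open>H n\<close> at a fixed point \<open>a\<close> tells on which side of \<open>a\<close> the zero lies, so each
  strict inequality between \<open>a\<close> and the zero is an open condition on \<open>n\<close>.
\<close>

lemma continuous_on_sign_change:
  fixes H :: "'a::topological_space \<Rightarrow> real \<Rightarrow> real" and c :: "'a \<Rightarrow> real"
  assumes c: "\<And>n. n \<in> I \<Longrightarrow> c n \<in> {0<..<1} \<and> H n (c n) = 0"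
    and pos: "\<And>n x. n \<in> I \<Longrightarrow> x \<in> {0<..<c n} \<Longrightarrow> 0 < H n x"
    and neg: "\<And>n x. n \<in> I \<Longrightarrow> x \<in> {c n<..<1} \<Longrightarrow> H n x < 0"
    and cont: "\<And>x. x \<in> {0<..<1} \<Longrightarrow> continuous_on I (\<lambda>n. H n x)"
  shows "continuous_on I c"
  unfolding continuous_on_def
proof
  fix n assume n: "n \<in> I"
  have in_I: "eventually (\<lambda>m. m \<in> I) (at n within I)"
    by (simp add: eventually_at_filter)
  have lim: "((\<lambda>m. H m x) \<longlongrightarrow> H n x) (at n within I)" if "x \<in> {0<..<1}" for x
    using cont[OF that] n by (simp add: continuous_on_def)
  show "(c \<longlongrightarrow> c n) (at n within I)"
  proof (rule order_tendstoI)
    fix a assume a: "a < c n"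
    show "eventually (\<lambda>m. a < c m) (at n within I)"
      \<comment> \<open>Outside the open unit interval \<open>H\<close> says nothing, but there the bound is trivial.\<close>
    proof (cases "0 < a")
      case True
      have a01: "a \<in> {0<..<1}" using True a c[OF n] by auto
      have "eventually (\<lambda>m. 0 < H m a) (at n within I)"
        using order_tendstoD(1)[OF lim[OF a01]] pos[OF n, of a] True a by auto
      with in_I show ?thesis
      proof eventually_elim
        case (elim m)
        then show ?case
          using neg[of m a] c[of m] a01 by (cases a "c m" rule: linorder_cases) auto
      qed
    next
      case False
      show ?thesis using in_I by eventually_elim (use False c in force)
    qed
  next
    fix a assume a: "c n < a"
    show "eventually (\<lambda>m. c m < a) (at n within I)"
    proof (cases "a < 1")
      case True
      have a01: "a \<in> {0<..<1}" using True a c[OF n] by auto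
      have "eventually (\<lambda>m. H m a < 0) (at n within I)"
        using order_tendstoD(2)[OF lim[OF a01]] neg[OF n, of a] True a by auto
      with in_I show ?thesis
      proof eventually_elim
        case (elim m)
        then show ?case
          using pos[of m a] c[of m] a01 by (cases a "c m" rule: linorder_cases) auto
      qed
    next
      case False
      show ?thesis using in_I by eventually_elim (use False c in force)
    qed
  qed
qed

lemma is_interval_strict_sublevel_of_strictly_convex:
  assumes "strictly_convex_on S h"
  shows "is_interval {x \<in> S. h x < (l::real)}"
  unfolding is_interval_convex_1
proof (rule convexI)
  fix x y u v :: real
  assume x: "x \<in> {x \<in> S. h x < l}" and y: "y \<in> {x \<in> S. h x < l}"
    and uv: "0 \<le> u" "0 \<le> v" "u + v = 1"
  have "u * x + v * y \<in> S"
    using assms x y uv convexD[of S x y u v] by (auto simp: strictly_convex_on_def)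
  moreover have "h (u * x + v * y) < l"
  proof (cases "x = y \<or> u = 0 \<or> v = 0")
    case True
    then have "u * x + v * y = x \<or> u * x + v * y = y"
      using uv by (auto simp flip: distrib_right)
    then show ?thesis using x y by auto
  next
    case False
    then have "h (u * x + v * y) < u * h x + v * h y"
      using assms x y uv by (auto simp: strictly_convex_on_def)
    also have "\<dots> < l"
      using convex_bound_lt[of "h x" l "h y" u v] x y uv by auto
    finally show ?thesis .
  qed
  ultimately show "u *\<^sub>R x + v *\<^sub>R y \<in> {x \<in> S. h x < l}" by simp
qed

section \<open>Continuous dependence of the crossing point\<close>

theorem proposition3p7:
  fixes I :: "real set"
    and F G f g t y :: "real \<Rightarrow> real \<Rightarrow> real"
  assumes interval: "is_interval I"
    and cdf_F: "\<And>n. n \<in> I \<Longrightarrow> cdf_with_density_on_unit (F n) (f n)"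
    and cdf_G: "\<And>n. n \<in> I \<Longrightarrow> cdf_with_density_on_unit (G n) (g n)"
    and cont_f: "\<And>x. x \<in> {0<..<1} \<Longrightarrow> continuous_on I (\<lambda>n. f n x)"
    and cont_g: "\<And>x. x \<in> {0<..<1} \<Longrightarrow> continuous_on I (\<lambda>n. g n x)"
    and pos: "\<And>n x. n \<in> I \<Longrightarrow> x \<in> {0<..<1} \<Longrightarrow> 0 < f n x \<and> 0 < g n x"
    and t_def: "\<And>n x. t n x = f n x / g n x"
    and t_pos: "\<And>n x. n \<in> I \<Longrightarrow> x \<in> {0<..<1} \<Longrightarrow> 0 < t n x"
    and t_convex: "\<And>n. n \<in> I \<Longrightarrow> strictly_convex_on {0<..<1} (t n)"
    and t_lim0: "\<And>n. n \<in> I \<Longrightarrow> filterlim (t n) at_top (at_right 0)"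
    and t_lim1: "\<And>n. n \<in> I \<Longrightarrow> filterlim (t n) at_top (at_left 1)"
    and cont_unit: "\<And>n. n \<in> I \<Longrightarrow> continuous_on {0..1} (f n) \<and> continuous_on {0..1} (g n)"
    and twice_diff: "\<And>n. n \<in> I \<Longrightarrow>
          twice_differentiable_on_open_unit (f n) \<and> twice_differentiable_on_open_unit (g n)"
    and t_second_deriv: "\<And>n x. n \<in> I \<Longrightarrow> x \<in> {0<..<1} \<Longrightarrow> 0 < deriv (deriv (t n)) x"
    and push_forward: "\<And>n. n \<in> I \<Longrightarrow> is_push_forward_map (f n) (g n) (y n)"
    and y_lim0: "\<And>n. n \<in> I \<Longrightarrow>
          \<exists>L::ereal. 1 < L \<and> ((\<lambda>x. ereal (deriv (y n) x)) \<longlongrightarrow> L) (at_right 0)"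
    and y_lim1: "\<And>n. n \<in> I \<Longrightarrow>
          \<exists>L::ereal. 1 < L \<and> ((\<lambda>x. ereal (deriv (y n) x)) \<longlongrightarrow> L) (at_left 1)"
  shows "(\<forall>n\<in>I. \<exists>!x. is_crossing (F n) (G n) x) \<and>
         continuous_on I (\<lambda>n. THE x. is_crossing (F n) (G n) x)"
proof -
  let ?H = "\<lambda>n x. F n x - G n x"
  have "\<exists>c. c \<in> {0<..<1} \<and> ?H n c = 0 \<and> (\<forall>x\<in>{0<..<c}. 0 < ?H n x) \<and> (\<forall>x\<in>{c<..<1}. ?H n x < 0)"
    if n: "n \<in> I" for n
  proof -
    have sign: "0 < f n x - g n x \<longleftrightarrow> 1 < t n x" "f n x - g n x < 0 \<longleftrightarrow> t n x < 1"
      if "x \<in> {0<..<1}" for x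
      using pos[OF n that] by (simp_all add: t_def)
    have at0: "eventually (\<lambda>x. x \<in> {0<..<1::real}) (at_right 0)"
      and at1: "eventually (\<lambda>x. x \<in> {0<..<1::real}) (at_left 1)"
      using eventually_at_right_real[of 0 "1::real"] eventually_at_left_real[of 0 "1::real"] by auto
    have "eventually (\<lambda>x. 1 < t n x) (at_right 0)" "eventually (\<lambda>x. 1 < t n x) (at_left 1)"
      using t_lim0[OF n] t_lim1[OF n] by (auto simp: filterlim_at_top_dense)
    then have ends: "eventually (\<lambda>x. 0 < f n x - g n x) (at_right 0)"
      "eventually (\<lambda>x. 0 < f n x - g n x) (at_left 1)"
      using eventually_conj[OF _ at0] eventually_conj[OF _ at1]
      by (blast intro: eventually_mono sign(1)[THEN iffD2])+
    have "{x \<in> {0<..<1}. f n x - g n x < 0} = {x \<in> {0<..<1}. t n x < 1}"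
      using sign(2) by blast
    then have neg: "is_interval {x \<in> {0<..<1}. f n x - g n x < 0}"
      using is_interval_strict_sublevel_of_strictly_convex[OF t_convex[OF n]] by simp
    have der: "(?H n has_real_derivative f n x - g n x) (at x within {0..1})" if "x \<in> {0..1}" for x
      using cdf_F cdf_G cont_unit n that
      by (intro DERIV_diff cdf_on_unit_has_derivative) auto
    have "?H n 0 = 0" "?H n 1 = 0"
      using cdf_F[OF n] cdf_G[OF n] cont_unit[OF n]
      by (simp_all add: cdf_on_unit_eq_integral[of "F n" "f n" 0] cdf_on_unit_at_1[of "F n" "f n"]
          cdf_on_unit_eq_integral[of "G n" "g n" 0] cdf_on_unit_at_1[of "G n" "g n"])
    then obtain c where "c \<in> {0<..<1}" "?H n c = 0"
      "\<And>x. x \<in> {0<..<c} \<Longrightarrow> 0 < ?H n x" "\<And>x. x \<in> {c<..<1} \<Longrightarrow> ?H n x < 0"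
      using sign_change_of_interval_decrease[of "?H n" "\<lambda>x. f n x - g n x", OF der _ _ ends neg]
      by blast
    then show ?thesis by blast
  qed
  then obtain c where c: "\<And>n. n \<in> I \<Longrightarrow> c n \<in> {0<..<1} \<and> ?H n (c n) = 0"
    and plus: "\<And>n x. n \<in> I \<Longrightarrow> x \<in> {0<..<c n} \<Longrightarrow> 0 < ?H n x"
    and minus: "\<And>n x. n \<in> I \<Longrightarrow> x \<in> {c n<..<1} \<Longrightarrow> ?H n x < 0"
    by metis
  have crossing: "is_crossing (F n) (G n) x \<longleftrightarrow> x = c n" if "n \<in> I" for n x
    using c[OF that] plus[OF that, of x] minus[OF that, of x]
    by (cases x "c n" rule: linorder_cases) (auto simp: is_crossing_def)
  have "continuous_on I (\<lambda>n. ?H n x)" if "x \<in> {0<..<1}" for x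
    using that cdf_F cdf_G cont_f cont_g
    by (intro continuous_on_diff continuous_on_cdf_param[of I F f] continuous_on_cdf_param[of I G g])
       auto
  with c plus minus have "continuous_on I c"
    by (intro continuous_on_sign_change[of I c ?H]) auto
  then have "continuous_on I (\<lambda>n. THE x. is_crossing (F n) (G n) x)"
    by (rule continuous_on_eq) (simp add: crossing)
  then show ?thesis
    by (simp add: crossing)
qed

end
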